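(* (Cassini's identity.) For every integer $n \ge 1$, \[ Q^P_{n-1}\,Q^P_{n+1} - (Q^P_n)^2 = (-1)^n\, 2\,(1 + i + 6\varepsilon + 6\,i\varepsilon). \]
   Context: Dual-complex numbers are expressions $x_1 + i\,x_2 + \varepsilon\,y_1 + i\varepsilon\,y_2$ with real coefficients, forming a commutative associative real algebra with basis $\{1,i,\varepsilon,i\varepsilon\}$, where $i^2=-1$, $\varepsilon\ne 0$, $\varepsilon^2=0$, $i\varepsilon=\varepsilon i$, $(i\varepsilon)^2=0$. Pell numbers: $P_0=0$, $P_1=1$, $P_n=2P_{n-1}+P_{n-2}$. The dual-complex Pell quaternion is $Q^P_n = P_n + i\,P_{n+1} + \varepsilon\,P_{n+2} + i\varepsilon\,P_{n+3}$, with products taken in the dual-complex algebra. *)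

theory Defs
  imports Complex_Main
begin

text \<open>
  \<open>DC x1 x2 y1 y2\<close> stands for \<open>x1 + i x2 + \<epsilon> y1 + i \<epsilon> y2\<close>.
\<close>

codatatype dual_complex =
  DC (cRe: real) (cIm: real) (cEps: real) (cIEps: real)

lemma dual_complex_eqI:
  "\<lbrakk>cRe x = cRe y; cIm x = cIm y; cEps x = cEps y; cIEps x = cIEps y\<rbrakk> \<Longrightarrow> x = y"
  by (rule dual_complex.expand) simp

lemma dual_complex_eq_iff:
  "x = y \<longleftrightarrow> cRe x = cRe y \<and> cIm x = cIm y \<and> cEps x = cEps y \<and> cIEps x = cIEps y"
  by (auto intro: dual_complex_eqI)

instantiation dual_complex :: "{comm_ring_1, real_algebra_1}"
begin

primcorec zero_dual_complex where
  "cRe 0 = 0" | "cIm 0 = 0" | "cEps 0 = 0" | "cIEps 0 = 0"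

primcorec one_dual_complex where
  "cRe 1 = 1" | "cIm 1 = 0" | "cEps 1 = 0" | "cIEps 1 = 0"

primcorec plus_dual_complex where
  "cRe (x + y) = cRe x + cRe y"
| "cIm (x + y) = cIm x + cIm y"
| "cEps (x + y) = cEps x + cEps y"
| "cIEps (x + y) = cIEps x + cIEps y"

primcorec uminus_dual_complex where
  "cRe (- x) = - cRe x"
| "cIm (- x) = - cIm x"
| "cEps (- x) = - cEps x"
| "cIEps (- x) = - cIEps x"

primcorec minus_dual_complex where
  "cRe (x - y) = cRe x - cRe y"
| "cIm (x - y) = cIm x - cIm y"
| "cEps (x - y) = cEps x - cEps y"
| "cIEps (x - y) = cIEps x - cIEps y"

primcorec scaleR_dual_complex where
  "cRe (r *\<^sub>R x) = r * cRe x"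
| "cIm (r *\<^sub>R x) = r * cIm x"
| "cEps (r *\<^sub>R x) = r * cEps x"
| "cIEps (r *\<^sub>R x) = r * cIEps x"

text \<open>
  The bilinear product determined by \<open>i\<^sup>2 = -1\<close>, \<open>\<epsilon>\<^sup>2 = 0\<close>, \<open>i \<epsilon> = \<epsilon> i\<close>
  (hence \<open>(i \<epsilon>)\<^sup>2 = 0\<close>).
\<close>

primcorec times_dual_complex where
  "cRe (x * y) = cRe x * cRe y - cIm x * cIm y"
| "cIm (x * y) = cRe x * cIm y + cIm x * cRe y"
| "cEps (x * y) = cRe x * cEps y + cEps x * cRe y - cIm x * cIEps y - cIEps x * cIm y"
| "cIEps (x * y) = cRe x * cIEps y + cIEps x * cRe y + cIm x * cEps y + cEps x * cIm y"

instance
  by standard (simp_all add: dual_complex_eq_iff algebra_simps)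

end

definition dc_i :: dual_complex where
  "dc_i = DC 0 1 0 0"

definition dc_eps :: dual_complex where
  "dc_eps = DC 0 0 1 0"

lemma dc_i_square: "dc_i\<^sup>2 = - 1"
  by (simp add: dc_i_def dual_complex_eq_iff power2_eq_square)

lemma dc_eps_nonzero: "dc_eps \<noteq> 0"
  by (simp add: dc_eps_def dual_complex_eq_iff)

lemma dc_eps_square: "dc_eps\<^sup>2 = 0"
  by (simp add: dc_eps_def dual_complex_eq_iff power2_eq_square)

lemma dc_i_eps_square: "(dc_i * dc_eps)\<^sup>2 = 0"
  by (simp add: power_mult_distrib dc_eps_square)

lemma DC_expand:
  "DC x1 x2 y1 y2 =
     x1 *\<^sub>R 1 + x2 *\<^sub>R dc_i + y1 *\<^sub>R dc_eps + y2 *\<^sub>R (dc_i * dc_eps)"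
  by (simp add: dc_i_def dc_eps_def dual_complex_eq_iff)

fun pell :: "nat \<Rightarrow> nat" where
  "pell 0 = 0"
| "pell (Suc 0) = 1"
| "pell (Suc (Suc n)) = 2 * pell (Suc n) + pell n"

definition pell_quat :: "nat \<Rightarrow> dual_complex" where
  "pell_quat n =
     of_nat (pell n) + dc_i * of_nat (pell (n + 1)) +
     dc_eps * of_nat (pell (n + 2)) + dc_i * dc_eps * of_nat (pell (n + 3))"

end

theory Submission
  imports Defs
begin

text \<open>With a and b two consecutive Pell numbers, all coefficients of the three quaternions are
  integer combinations of a and b. Expanding with i^2 = -1 and \<epsilon>^2 = 0, each coefficient of
  the left side is a multiple (2, 2, 12, 12) of a(2b + a) - b^2, which \<open>pell_cassini\<close>
  evaluates to the sign. That lemma is stated over any commutative ring so that it applies inside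
  \<open>dual_complex\<close>.\<close>

lemma pell_cassini:
  "of_nat (pell n) * of_nat (pell (n + 2)) - (of_nat (pell (n + 1)))\<^sup>2 =
    ((- 1) ^ (n + 1) :: 'a :: comm_ring_1)"
proof (induction n)
  case (Suc n)
  \<comment> \<open>Expanding one factor of each product by the recurrence, the cross terms 2
    P_(n+1) P_(n+2) cancel.\<close>
  have "of_nat (pell (Suc n)) * of_nat (pell (Suc n + 2)) - (of_nat (pell (Suc n + 1)))\<^sup>2 =
      - (of_nat (pell n) * of_nat (pell (n + 2)) - (of_nat (pell (n + 1)))\<^sup>2 :: 'a)"
    by (simp add: power2_eq_square algebra_simps)
  with Suc show ?case by simp
qed simp

theorem theorem3p6:
  fixes n :: nat
  assumes "n \<ge> 1"
  shows "pell_quat (n - 1) * pell_quat (n + 1) - (pell_quat n)\<^sup>2 =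
    (- 1) ^ n * 2 * (1 + dc_i + 6 * dc_eps + 6 * (dc_i * dc_eps))"
proof -
  from assms obtain m where n: "n = Suc m"
    by (cases n) auto
  define a b :: dual_complex where "a = of_nat (pell m)" and "b = of_nat (pell (Suc m))"
  let ?i = dc_i and ?e = dc_eps
  have Q: "pell_quat m = a + ?i * b + ?e * (2 * b + a) + ?i * ?e * (5 * b + 2 * a)"
    "pell_quat (Suc m) =
      b + ?i * (2 * b + a) + ?e * (5 * b + 2 * a) + ?i * ?e * (12 * b + 5 * a)"
    "pell_quat (Suc (Suc m)) =
      (2 * b + a) + ?i * (5 * b + 2 * a) + ?e * (12 * b + 5 * a) + ?i * ?e * (29 * b + 12 * a)"
    by (simp_all add: pell_quat_def a_def b_def numeral_3_eq_3 algebra_simps)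
  \<comment> \<open>Here 2b + a is P_(m+2), and the exponent m + 1 is n.\<close>
  have sign: "(- 1) ^ n = a * (2 * b + a) - b\<^sup>2"
    using pell_cassini[of m, where 'a = dual_complex] by (simp add: n a_def b_def)
  have ii: "?i * ?i = - 1" and ee: "?e * ?e = 0"
    using dc_i_square dc_eps_square by (simp_all add: power2_eq_square)
  \<comment> \<open>Right-nested products hide i^2 and \<epsilon>^2, so these forms are needed for
    rewriting.\<close>
  have ii': "?i * (?i * x) = - x" and ee': "?e * (?e * x) = 0" for x
    by (simp_all add: ii ee flip: mult.assoc)
  have "pell_quat m * pell_quat (Suc (Suc m)) - (pell_quat (Suc m))\<^sup>2 =
      (a * (2 * b + a) - b\<^sup>2) * 2 * (1 + ?i + 6 * ?e + 6 * (?i * ?e))"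
    unfolding Q by (simp add: power2_eq_square algebra_simps ii ii' ee ee')
  then show ?thesis
    unfolding sign by (simp add: n)
qed

end
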